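(* For every dimension $d$, integers $t\ge 2$, $k\ge 1$ and every convex polytope $P$ in $\mathbb{R}^d$ there exists an integer $m=m(t,k,P)$ with the following property: the (unordered) $t$-tuples of every finite point set $S\subset\mathbb{R}^d$ can be $k$-colored such that every homothet of $P$ that contains at least $m$ points of $S$ contains a $t$-tuple of points of $S$ of each of the $k$ colors.
   Context: A homothet of $P$ is a set of the form $\lambda P+v$ with $\lambda>0$ and $v\in\mathbb{R}^d$ (scaling and translation, no rotation). A $t$-tuple of points of $S$ is a $t$-element subset of $S$; a region contains it if it contains all its points. *)

theory Defs
  imports "HOL-Analysis.Analysis"
begin

definition homothet :: "'a::real_vector set \<Rightarrow> 'a set \<Rightarrow> bool" where
  "homothet P H \<longleftrightarrow> (\<exists>lam v. lam > 0 \<and> H = (\<lambda>x. lam *\<^sub>R x + v) ` P)"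

end

theory Submission
  imports Defs "HOL-Library.Ramsey"
begin

text \<open>
  Let \<open>P\<close> be cut out by finitely many half-spaces with normals \<open>a \<in> A\<close>, and number the points
  of \<open>S\<close> by an injection \<open>g\<close>. Call a set of points coherent if, listed along \<open>g\<close>, every linear
  form \<open>a \<bullet> x\<close> is strictly increasing or weakly decreasing on it. By Ramsey's theorem each large
  point set contains a coherent set of prescribed size. A homothet of \<open>P\<close> that contains the two
  ends of a coherent set contains all of it, since each \<open>a \<bullet> x\<close> is bounded by its values at the
  ends. Colour a tuple by the maximal size, modulo \<open>k\<close>, of a coherent set having the same first
  and last point. If \<open>C\<close> is a coherent set of maximal size between its ends, then so is each of
  its initial segments, hence the tuples inside \<open>C\<close> realise all sizes from \<open>t\<close> to \<open>card C\<close>.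
\<close>

section \<open>Coherent sets and their Ramsey property\<close>

text \<open>Strict increase is paired with weak decrease so that the two alternatives exclude each
  other on every pair with \<open>g x < g y\<close>: one such pair decides the direction of a form,
  and ties of \<open>f i\<close> need no separate treatment.\<close>

definition coherent :: "('i \<Rightarrow> 'a \<Rightarrow> 'b::linorder) \<Rightarrow> 'i set \<Rightarrow> ('a \<Rightarrow> 'c::linorder) \<Rightarrow> 'a set \<Rightarrow> bool"
  where "coherent f I g C \<longleftrightarrow>
    (\<forall>i\<in>I. (\<forall>x\<in>C. \<forall>y\<in>C. g x < g y \<longrightarrow> f i x < f i y) \<or>
           (\<forall>x\<in>C. \<forall>y\<in>C. g x < g y \<longrightarrow> f i y \<le> f i x))"

text \<open>The ends are shared points, not merely equal values of \<open>g\<close>. This makes the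
  relation false if either set is empty.\<close>

definition same_ends :: "('a \<Rightarrow> 'c::linorder) \<Rightarrow> 'a set \<Rightarrow> 'a set \<Rightarrow> bool"
  where "same_ends g T C \<longleftrightarrow>
    (\<exists>p \<in> T \<inter> C. \<exists>q \<in> T \<inter> C. \<forall>x \<in> T \<union> C. g p \<le> g x \<and> g x \<le> g q)"

text \<open>For finite \<open>S\<close> and nonempty \<open>T \<subseteq> S\<close> the maximum is
  over a nonempty family: a first and a last point of \<open>T\<close> already form a coherent
  set.\<close>

definition coherent_size ::
    "('i \<Rightarrow> 'a \<Rightarrow> 'b::linorder) \<Rightarrow> 'i set \<Rightarrow> ('a \<Rightarrow> 'c::linorder) \<Rightarrow> 'a set \<Rightarrow> 'a set \<Rightarrow> nat"
  where "coherent_size f I g S T = Max (card ` {C. C \<subseteq> S \<and> coherent f I g C \<and> same_ends g T C})"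

lemma coherent_subset: "coherent f I g C \<Longrightarrow> D \<subseteq> C \<Longrightarrow> coherent f I g D"
  unfolding coherent_def by (meson subsetD)

text \<open>Induction on \<open>I\<close>, with one application of Ramsey's theorem for graphs per
  form. The size \<open>n\<close> stays arbitrary, because the hypothesis must deliver a set large
  enough for that application. The bound \<open>N\<close> is uniform in \<open>g\<close> and
  \<open>V\<close>.\<close>

lemma coherent_Ramsey:
  fixes f :: "'i \<Rightarrow> 'a \<Rightarrow> 'b::linorder"
  assumes "finite I"
  shows "\<exists>N. \<forall>(g :: 'a \<Rightarrow> 'c::linorder) V. finite V \<and> N \<le> card V \<longrightarrow>
           (\<exists>R\<subseteq>V. card R = n \<and> coherent f I g R)"
  using assms
proof (induction I arbitrary: n rule: finite_induct)
  case empty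
  show ?case
    by (rule exI[of _ n]) (metis coherent_def empty_iff obtain_subset_with_card_n)
next
  case (insert i I)
  obtain r where r: "\<And>(V :: 'a set) E. finite V \<Longrightarrow> r \<le> card V \<Longrightarrow>
      \<exists>R\<subseteq>V. card R = n \<and> clique R E \<or> card R = n \<and> indep R E"
    using ramsey2[of n n] by metis
  obtain N where N: "\<And>(g :: 'a \<Rightarrow> 'c) V. finite V \<Longrightarrow> N \<le> card V \<Longrightarrow>
      \<exists>R\<subseteq>V. card R = r \<and> coherent f I g R"
    using insert.IH[of r] by metis
  show ?case
  proof (rule exI[of _ N], intro allI impI)
    fix g :: "'a \<Rightarrow> 'c" and V :: "'a set"
    assume V: "finite V \<and> N \<le> card V"
    then obtain W where W: "W \<subseteq> V" "card W = r" "coherent f I g W"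
      using N by blast
    \<comment> \<open>Edges are the pairs on which form \<open>i\<close> increases along
      \<open>g\<close>; cliques and independent sets then match the two alternatives in
      \<open>coherent\<close>.\<close>
    define E where "E = {{x, y} | x y. g x < g y \<and> f i x < f i y}"
    have E: "{x, y} \<in> E \<longleftrightarrow> f i x < f i y" if "g x < g y" for x y
      using that by (auto simp: E_def doubleton_eq_iff)
    have "finite W" using W V finite_subset by blast
    then obtain R where R: "R \<subseteq> W" "card R = n" "clique R E \<or> indep R E"
      using r[of W E] W by auto
    have "(\<forall>x\<in>R. \<forall>y\<in>R. g x < g y \<longrightarrow> f i x < f i y) \<or>
          (\<forall>x\<in>R. \<forall>y\<in>R. g x < g y \<longrightarrow> f i y \<le> f i x)"
      using R(3)
    proof
      assume "clique R E"
      then show ?thesis unfolding clique_def by (metis E less_irrefl)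
    next
      assume "indep R E"
      then show ?thesis unfolding indep_def by (metis E less_irrefl not_le)
    qed
    moreover have "coherent f I g R" using W(3) R(1) by (rule coherent_subset)
    ultimately have "coherent f (insert i I) g R" by (simp add: coherent_def)
    then show "\<exists>R\<subseteq>V. card R = n \<and> coherent f (insert i I) g R"
      using R W by blast
  qed
qed

section \<open>Bounds by the ends, and gluing\<close>

lemma coherent_le_max:
  assumes "coherent f I g C" "inj_on g C" "i \<in> I" "p \<in> C" "q \<in> C" "x \<in> C" "g p \<le> g x" "g x \<le> g q"
  shows "f i x \<le> max (f i p) (f i q)"
proof (cases "x = p \<or> x = q")
  case False
  then have "g p < g x" "g x < g q"
    using assms by (metis inj_onD order_le_less)+
  moreover have "(\<forall>x\<in>C. \<forall>y\<in>C. g x < g y \<longrightarrow> f i x < f i y) \<or>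
      (\<forall>x\<in>C. \<forall>y\<in>C. g x < g y \<longrightarrow> f i y \<le> f i x)"
    using assms(1,3) unfolding coherent_def by blast
  ultimately have "f i x \<le> f i q \<or> f i x \<le> f i p"
    using assms(4-6) by (auto dest: less_imp_le)
  then show ?thesis by (auto simp: le_max_iff_disj)
qed auto

text \<open>The common pair \<open>p\<close>, \<open>z\<close> fixes the direction of each form in
  both \<open>C\<close> and \<open>D\<close>, so the directions agree; points on different sides of
  the join are compared through \<open>z\<close>.\<close>

lemma coherent_glue:
  assumes C: "coherent f I g C" "p \<in> C" "z \<in> C"
    and D: "coherent f I g D" "p \<in> D" "z \<in> D"
    and pz: "g p < g z" and top: "\<forall>x\<in>D. g x \<le> g z"
    and inj: "inj_on g D"
  shows "coherent f I g (D \<union> {x \<in> C. g z < g x})" (is "coherent f I g ?U")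
  unfolding coherent_def
proof
  fix i assume i: "i \<in> I"
  have Dz: "x = z \<or> g x < g z" if "x \<in> D" for x
    using that top inj D(3) by (metis inj_onD order_le_less)
  show "(\<forall>x\<in>?U. \<forall>y\<in>?U. g x < g y \<longrightarrow> f i x < f i y) \<or>
        (\<forall>x\<in>?U. \<forall>y\<in>?U. g x < g y \<longrightarrow> f i y \<le> f i x)"
  proof (cases "f i p < f i z")
    case True
    then have c: "\<And>x y. x \<in> C \<Longrightarrow> y \<in> C \<Longrightarrow> g x < g y \<Longrightarrow> f i x < f i y"
      and d: "\<And>x y. x \<in> D \<Longrightarrow> y \<in> D \<Longrightarrow> g x < g y \<Longrightarrow> f i x < f i y"
      using C D i pz unfolding coherent_def by (metis not_le)+
    have "f i x < f i y" if "x \<in> ?U" "y \<in> ?U" "g x < g y" for x y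
    proof -
      \<comment> \<open>The remaining combination, \<open>x\<close> beyond \<open>z\<close> and
        \<open>y\<close> in \<open>D\<close>, would give \<open>g y \<le> g z < g x\<close>.\<close>
      consider "x \<in> D" "y \<in> D" | "x \<in> C" "y \<in> C" | "x \<in> D" "y \<in> C" "g z < g y"
        using \<open>x \<in> ?U\<close> \<open>y \<in> ?U\<close> \<open>g x < g y\<close> top by fastforce
      then show ?thesis
        using c d Dz[of x] C(3) D(3) that(3) by cases (blast, blast, metis less_trans)
    qed
    then show ?thesis by blast
  next
    case False
    then have c: "\<And>x y. x \<in> C \<Longrightarrow> y \<in> C \<Longrightarrow> g x < g y \<Longrightarrow> f i y \<le> f i x"
      and d: "\<And>x y. x \<in> D \<Longrightarrow> y \<in> D \<Longrightarrow> g x < g y \<Longrightarrow> f i y \<le> f i x"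
      using C D i pz unfolding coherent_def by metis+
    have "f i y \<le> f i x" if "x \<in> ?U" "y \<in> ?U" "g x < g y" for x y
    proof -
      consider "x \<in> D" "y \<in> D" | "x \<in> C" "y \<in> C" | "x \<in> D" "y \<in> C" "g z < g y"
        using \<open>x \<in> ?U\<close> \<open>y \<in> ?U\<close> \<open>g x < g y\<close> top by fastforce
      then show ?thesis
        using c d Dz[of x] C(3) D(3) that(3) by cases (blast, blast, metis order_trans)
    qed
    then show ?thesis by blast
  qed
qed

section \<open>Tuples of prescribed coherent size\<close>

text \<open>The rank of a point is injective on \<open>C\<close> with values in
  \<open>{1..card C}\<close>, so by counting it takes every value there.\<close>

lemma exists_initial_segment_card:
  fixes g :: "'a \<Rightarrow> 'c::linorder"
  assumes "finite C" "inj_on g C" "1 \<le> j" "j \<le> card C"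
  shows "\<exists>z\<in>C. card {y \<in> C. g y \<le> g z} = j"
proof -
  let ?r = "\<lambda>z. card {y \<in> C. g y \<le> g z}"
  have less: "?r x < ?r y" if "x \<in> C" "y \<in> C" "g x < g y" for x y
  proof (rule psubset_card_mono)
    have "y \<notin> {v \<in> C. g v \<le> g x}" "y \<in> {v \<in> C. g v \<le> g y}" using that by auto
    moreover have "{v \<in> C. g v \<le> g x} \<subseteq> {v \<in> C. g v \<le> g y}" using that by auto
    ultimately show "{v \<in> C. g v \<le> g x} \<subset> {v \<in> C. g v \<le> g y}" by blast
  qed (use assms(1) in simp)
  have "inj_on ?r C"
  proof (rule inj_onI, rule ccontr)
    fix x y assume xy: "x \<in> C" "y \<in> C" "?r x = ?r y" "x \<noteq> y"
    then have "g x < g y \<or> g y < g x" using assms(2) by (metis inj_onD linorder_cases)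
    then show False using less[OF xy(1,2)] less[OF xy(2,1)] xy(3) by linarith
  qed
  moreover have "?r ` C \<subseteq> {1..card C}"
  proof (rule image_subsetI)
    fix z assume "z \<in> C"
    then have "{y \<in> C. g y \<le> g z} \<noteq> {}" by blast
    then have "0 < ?r z" using assms(1) by (simp add: card_gt_0_iff)
    moreover have "?r z \<le> card C" using assms(1) by (intro card_mono) auto
    ultimately show "?r z \<in> {1..card C}" by simp
  qed
  ultimately have "?r ` C = {1..card C}"
    by (intro card_subset_eq) (auto simp: card_image)
  then have "j \<in> ?r ` C" using assms(3,4) by simp
  then show ?thesis by blast
qed

lemma exists_maximal_coherent:
  assumes S: "finite S" and R: "R \<subseteq> S" "coherent f I g R" "same_ends g T R"
  obtains C where "C \<subseteq> S" "coherent f I g C" "same_ends g T C" "card C = coherent_size f I g S T"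
    and "\<And>D. D \<subseteq> S \<Longrightarrow> coherent f I g D \<Longrightarrow> same_ends g T D \<Longrightarrow> card D \<le> card C"
proof -
  let ?\<C> = "{C. C \<subseteq> S \<and> coherent f I g C \<and> same_ends g T C}"
  have fin: "finite ?\<C>" using S by (auto intro: finite_subset[of _ "Pow S"])
  have "R \<in> ?\<C>" using R by simp
  then have "Max (card ` ?\<C>) \<in> card ` ?\<C>" by (intro Max_in) (use fin in auto)
  then obtain C where C: "C \<in> ?\<C>" "card C = Max (card ` ?\<C>)" by auto
  have "card D \<le> card C" if "D \<in> ?\<C>" for D
    unfolding C(2) by (rule Max_ge) (use that fin in auto)
  then show thesis using that C unfolding coherent_size_def by auto
qed

text \<open>Exchange argument: \<open>T\<close> gets the ends of the initial segment
  \<open>B\<close> of \<open>C\<close> with \<open>j\<close> points. A larger coherent set with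
  these ends could replace \<open>B\<close> in \<open>C\<close>, against the maximality of
  \<open>C\<close>.\<close>

lemma exists_tuple_coherent_size:
  fixes g :: "'a \<Rightarrow> 'c::linorder"
  assumes S: "finite S" "inj_on g S" and C: "C \<subseteq> S" "coherent f I g C"
    and max: "\<And>D. D \<subseteq> S \<Longrightarrow> coherent f I g D \<Longrightarrow> same_ends g C D \<Longrightarrow> card D \<le> card C"
    and j: "2 \<le> t" "t \<le> j" "j \<le> card C"
  shows "\<exists>T\<subseteq>C. card T = t \<and> coherent_size f I g S T = j"
proof -
  have finC: "finite C" and injC: "inj_on g C"
    using S C finite_subset inj_on_subset by blast+
  have "C \<noteq> {}" using j by auto
  obtain p where p: "p \<in> C" "\<And>x. x \<in> C \<Longrightarrow> g p \<le> g x"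
    using ex_min_if_finite[of "g ` C"] finC \<open>C \<noteq> {}\<close> by (auto simp: not_less)
  obtain q where q: "q \<in> C" "\<And>x. x \<in> C \<Longrightarrow> g x \<le> g q"
    using obtains_MAX[OF finC \<open>C \<noteq> {}\<close>, of g] finC by (metis Max_ge finite_imageI imageI)
  obtain z where z: "z \<in> C" "card {y \<in> C. g y \<le> g z} = j"
    using exists_initial_segment_card[OF finC injC, of j] j by auto
  define B where "B = {y \<in> C. g y \<le> g z}"
  have B: "B \<subseteq> C" "finite B" "card B = j" "p \<in> B" "z \<in> B"
    using z p finC by (auto simp: B_def)
  have pz: "g p < g z"
  proof (rule ccontr)
    assume "\<not> g p < g z"
    then have "B \<subseteq> {p}" using p injC by (auto simp: B_def) (metis inj_onD order_antisym order_trans not_less)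
    then have "card B \<le> card {p}" by (intro card_mono) auto
    then show False using B(3) j by simp
  qed
  have "p \<noteq> z" using pz by blast
  then have "card (B - {p, z}) = j - 2"
    using B by (subst card_Diff_subset) auto
  \<comment> \<open>Two places of the tuple are reserved for the ends \<open>p\<close> and
    \<open>z\<close>; \<open>t \<le> j\<close> leaves enough points for the rest.\<close>
  then obtain T' where T': "T' \<subseteq> B - {p, z}" "card T' = t - 2"
    using obtain_subset_with_card_n[of "t - 2" "B - {p, z}"] j by (metis diff_le_mono)
  define T where "T = insert p (insert z T')"
  have "finite T'" using T' B finite_subset by blast
  then have cT: "card T = t"
    using T' pz j by (subst T_def, subst card_insert_disjoint, simp, force, subst card_insert_disjoint) auto
  have TB: "T \<subseteq> B" "p \<in> T" "z \<in> T" using T' B by (auto simp: T_def)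
  have Bends: "g p \<le> g x \<and> g x \<le> g z" if "x \<in> B" for x
    using that p by (auto simp: B_def)
  have "same_ends g T B"
    unfolding same_ends_def using TB B Bends by blast
  moreover have "coherent f I g B" using C(2) B(1) by (rule coherent_subset)
  moreover have "B \<subseteq> S" using B C by blast
  ultimately obtain D where D: "D \<subseteq> S" "coherent f I g D" "same_ends g T D"
      "card D = coherent_size f I g S T"
    and Dmax: "\<And>E. E \<subseteq> S \<Longrightarrow> coherent f I g E \<Longrightarrow> same_ends g T E \<Longrightarrow> card E \<le> card D"
    using exists_maximal_coherent[OF S(1)] by metis
  have lower: "j \<le> card D"
    using Dmax[OF \<open>B \<subseteq> S\<close> \<open>coherent f I g B\<close> \<open>same_ends g T B\<close>] B by simp
  obtain p' q' where pq': "p' \<in> T \<inter> D" "q' \<in> T \<inter> D" "\<And>x. x \<in> T \<union> D \<Longrightarrow> g p' \<le> g x \<and> g x \<le> g q'"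
    using D(3) unfolding same_ends_def by blast
  have TS: "T \<subseteq> S" using TB \<open>B \<subseteq> S\<close> by blast
  \<comment> \<open>Both pairs are extreme in \<open>T\<close>, so their values agree; injectivity
    of \<open>g\<close> then identifies the points.\<close>
  have "g p' = g p" "g q' = g z"
    using pq' TB Bends by (meson IntD1 UnI1 order_antisym subsetD)+
  then have "p' = p" "q' = z"
    using S(2) TS TB pq' by (meson IntD1 inj_onD subsetD)+
  then have pD: "p \<in> D" and zD: "z \<in> D" and Dends: "\<And>x. x \<in> D \<Longrightarrow> g p \<le> g x \<and> g x \<le> g z"
    using pq' by auto
  let ?U = "D \<union> {x \<in> C. g z < g x}"
  have "coherent f I g ?U"
    by (rule coherent_glue[OF C(2) p(1) z(1) D(2) pD zD pz])
      (use Dends S(2) D(1) inj_on_subset in blast)+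
  moreover have "?U \<subseteq> S" using C D by blast
  moreover have "same_ends g C ?U"
  proof -
    have "q \<in> ?U"
    proof (cases "g z < g q")
      case False
      then have "q = z" using q z injC by (metis inj_onD order_antisym not_less)
      then show ?thesis using zD by simp
    qed (use q in auto)
    moreover have "g p \<le> g x \<and> g x \<le> g q" if "x \<in> C \<union> ?U" for x
      using that p q z Dends by (auto intro: order_trans)
    ultimately show ?thesis
      unfolding same_ends_def using p q pD by blast
  qed
  ultimately have "card ?U \<le> card C" using max by blast
  moreover have "finite D" using D S finite_subset by blast
  \<comment> \<open>\<open>?U\<close> and \<open>C\<close> have the same part beyond
    \<open>z\<close>, so it cancels and leaves \<open>card D \<le> card B\<close>.\<close>
  then have "card ?U = card D + card {x \<in> C. g z < g x}"
    using finC Dends by (intro card_Un_disjoint) (auto simp: not_less[symmetric])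
  moreover have "card C = card B + card {x \<in> C. g z < g x}"
    using finC by (subst card_Un_disjoint[symmetric]) (auto simp: B_def intro!: arg_cong[of _ _ card])
  ultimately have "card D \<le> j" using B by simp
  then show ?thesis
    using lower D(4) cT TB B by (intro exI[of _ T]) auto
qed

text \<open>The set \<open>H\<close> stands for the trace of a homothet on \<open>S\<close>, with
  \<open>closed\<close> as its only geometric property. A maximal coherent set with the ends of
  \<open>R\<close> stays in \<open>H\<close> and has at least \<open>t + k\<close> points, so the
  sizes available cover all residues modulo \<open>k\<close>.\<close>

lemma coherent_size_colouring:
  fixes g :: "'a \<Rightarrow> 'c::linorder"
  assumes S: "finite S" "inj_on g S" and H: "H \<subseteq> S"
    and closed: "\<And>p q x. p \<in> H \<Longrightarrow> q \<in> H \<Longrightarrow> x \<in> S \<Longrightarrow>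
                   (\<And>i. i \<in> I \<Longrightarrow> f i x \<le> max (f i p) (f i q)) \<Longrightarrow> x \<in> H"
    and R: "R \<subseteq> H" "coherent f I g R" "card R = t + k"
    and t: "2 \<le> t" and l: "l < k"
  shows "\<exists>T\<subseteq>H. card T = t \<and> coherent_size f I g S T mod k = l"
proof -
  have RS: "R \<subseteq> S" "finite R" "R \<noteq> {}"
    using R H S(1) t finite_subset[of R S] by auto
  obtain p where p: "p \<in> R" "\<And>x. x \<in> R \<Longrightarrow> g p \<le> g x"
    using ex_min_if_finite[of "g ` R"] RS by (auto simp: not_less)
  obtain q where q: "q \<in> R" "\<And>x. x \<in> R \<Longrightarrow> g x \<le> g q"
    using obtains_MAX[OF RS(2,3), of g] RS by (metis Max_ge finite_imageI imageI)
  have self: "same_ends g {p, q} R"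
    unfolding same_ends_def using p q by blast
  obtain C where C: "C \<subseteq> S" "coherent f I g C" "same_ends g {p, q} C"
    and Cmax: "\<And>D. D \<subseteq> S \<Longrightarrow> coherent f I g D \<Longrightarrow> same_ends g {p, q} D \<Longrightarrow> card D \<le> card C"
    using exists_maximal_coherent[OF S(1) RS(1) R(2) self] by metis
  obtain p' q' where pq': "p' \<in> {p, q} \<inter> C" "q' \<in> {p, q} \<inter> C"
      "\<And>x. x \<in> {p, q} \<union> C \<Longrightarrow> g p' \<le> g x \<and> g x \<le> g q'"
    using C(3) unfolding same_ends_def by blast
  have injC: "inj_on g C" using S C inj_on_subset by blast
  \<comment> \<open>\<open>C\<close> may leave \<open>R\<close>, but its ends lie in
    \<open>R\<close> and hence in \<open>H\<close>, and they bound every form on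
    \<open>C\<close>.\<close>
  have CH: "C \<subseteq> H"
  proof
    fix x assume x: "x \<in> C"
    have "f i x \<le> max (f i p') (f i q')" if "i \<in> I" for i
      using coherent_le_max[OF C(2) injC that] pq' x by blast
    then show "x \<in> H"
      using closed[of p' q' x] pq'(1,2) p(1) q(1) R(1) C(1) x by blast
  qed
  \<comment> \<open>Maximality is carried over from the ends of \<open>{p, q}\<close> to those of
    \<open>C\<close>, which are the same points.\<close>
  have "card D \<le> card C" if D: "D \<subseteq> S" "coherent f I g D" "same_ends g C D" for D
  proof -
    obtain a b where ab: "a \<in> C \<inter> D" "b \<in> C \<inter> D" "\<And>x. x \<in> C \<union> D \<Longrightarrow> g a \<le> g x \<and> g x \<le> g b"
      using D(3) unfolding same_ends_def by blast
    have "g a = g p'" "g b = g q'"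
      using ab pq' by (meson IntD1 IntD2 UnI1 UnI2 order_antisym)+
    then have "a = p'" "b = q'"
      using injC ab pq' by (meson IntD1 IntD2 inj_onD)+
    then have "same_ends g {p, q} D"
      unfolding same_ends_def using ab pq' by blast
    then show ?thesis using Cmax D by blast
  qed
  \<comment> \<open>The number in \<open>{t..<t + k}\<close> congruent to \<open>l\<close> modulo
    \<open>k\<close>; adding \<open>k * t\<close> keeps the natural subtraction of \<open>t\<close>
    from truncating.\<close>
  moreover define j where "j = t + (l + (k * t - t)) mod k"
  have "j mod k = (l + k * t) mod k"
  proof -
    have "t \<le> k * t" using l by (cases k) auto
    then have "t + (l + (k * t - t)) = l + k * t" by linarith
    then show ?thesis unfolding j_def by (metis mod_add_right_eq)
  qed
  then have jl: "j mod k = l" using l by simp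
  have "j \<le> t + k" unfolding j_def using l by (simp add: less_imp_le)
  then have "j \<le> card C" using Cmax[OF RS(1) R(2) self] R(3) by simp
  ultimately obtain T where "T \<subseteq> C" "card T = t" "coherent_size f I g S T = j"
    using exists_tuple_coherent_size[OF S C(1,2), of t j] t j_def by auto
  then show ?thesis using CH jl by blast
qed

section \<open>Homothets of polyhedra\<close>

text \<open>Scaling by a positive factor and translating change the offsets of the half-spaces but
  not their normals, so one finite \<open>A\<close> serves all homothets.\<close>

lemma homothet_polyhedron_closed:
  fixes P :: "'a::euclidean_space set"
  assumes "polyhedron P"
  obtains A where "finite A"
    and "\<And>H p q x. homothet P H \<Longrightarrow> p \<in> H \<Longrightarrow> q \<in> H \<Longrightarrow>
           (\<And>a. a \<in> A \<Longrightarrow> a \<bullet> x \<le> max (a \<bullet> p) (a \<bullet> q)) \<Longrightarrow> x \<in> H"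
proof -
  obtain F where F: "finite F" "P = \<Inter>F" "\<forall>h\<in>F. \<exists>a b. a \<noteq> 0 \<and> h = {x. a \<bullet> x \<le> b}"
    using assms unfolding polyhedron_def by blast
  then obtain a b where ab: "\<And>h. h \<in> F \<Longrightarrow> h = {x. a h \<bullet> x \<le> b h}" by metis
  have P: "x \<in> P \<longleftrightarrow> (\<forall>h\<in>F. a h \<bullet> x \<le> b h)" for x
    using F(2) ab by blast
  have "x \<in> H"
    if H: "homothet P H" "p \<in> H" "q \<in> H" and x: "\<And>c. c \<in> a ` F \<Longrightarrow> c \<bullet> x \<le> max (c \<bullet> p) (c \<bullet> q)"
    for H p q x
  proof -
    obtain lam v where lam: "lam > 0" "H = (\<lambda>x. lam *\<^sub>R x + v) ` P"
      using H(1) unfolding homothet_def by blast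
    have bound: "a h \<bullet> y \<le> lam * b h + a h \<bullet> v" if "y \<in> H" "h \<in> F" for y h
      using that lam P by (auto simp: inner_add_right)
    let ?w = "(1 / lam) *\<^sub>R (x - v)"
    have "a h \<bullet> ?w \<le> b h" if "h \<in> F" for h
    proof -
      have "a h \<bullet> x \<le> max (a h \<bullet> p) (a h \<bullet> q)" using x that by blast
      also have "\<dots> \<le> lam * b h + a h \<bullet> v" using bound H that by simp
      finally show ?thesis using lam(1) by (simp add: inner_diff_right field_simps)
    qed
    then have "?w \<in> P" using P by blast
    moreover have "x = lam *\<^sub>R ?w + v" using lam(1) by simp
    ultimately show "x \<in> H" unfolding lam(2) by (rule rev_image_eqI)
  qed
  then show thesis using that[of "a ` F"] F(1) by blast
qed

theorem theorem6:
  fixes P :: "'a::euclidean_space set" and t k :: nat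
  assumes "t \<ge> 2" and "k \<ge> 1" and "polytope P"
  shows "\<exists>m::nat. \<forall>S::'a set. finite S \<longrightarrow>
           (\<exists>c :: 'a set \<Rightarrow> nat.
              (\<forall>T. T \<subseteq> S \<and> card T = t \<longrightarrow> c T < k) \<and>
              (\<forall>H. homothet P H \<and> card (H \<inter> S) \<ge> m \<longrightarrow>
                 (\<forall>i<k. \<exists>T. T \<subseteq> H \<inter> S \<and> card T = t \<and> c T = i)))"
proof -
  obtain A where A: "finite A"
    and closed: "\<And>H p q x. homothet P H \<Longrightarrow> p \<in> H \<Longrightarrow> q \<in> H \<Longrightarrow>
           (\<And>a. a \<in> A \<Longrightarrow> a \<bullet> x \<le> max (a \<bullet> p) (a \<bullet> q)) \<Longrightarrow> x \<in> H"
    using homothet_polyhedron_closed[OF polytope_imp_polyhedron[OF assms(3)]] by metis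
  \<comment> \<open>Uniformity in the numbering and the point set lets \<open>m\<close> be fixed
    before \<open>S\<close> and \<open>g\<close> are given.\<close>
  obtain m where m: "\<And>(g :: 'a \<Rightarrow> nat) V. finite V \<Longrightarrow> m \<le> card V \<Longrightarrow>
      \<exists>R\<subseteq>V. card R = t + k \<and> coherent (\<bullet>) A g R"
    using coherent_Ramsey[OF A, of "t + k" "(\<bullet>)"] by metis
  show ?thesis
  proof (rule exI[of _ m], intro allI impI)
    fix S :: "'a set" assume S: "finite S"
    then obtain g :: "'a \<Rightarrow> nat" where g: "inj_on g S"
      using finite_imp_inj_to_nat_seg by metis
    have "\<exists>T\<subseteq>H \<inter> S. card T = t \<and> coherent_size (\<bullet>) A g S T mod k = i"
      if H: "homothet P H" "m \<le> card (H \<inter> S)" and i: "i < k" for H i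
    proof -
      obtain R where R: "R \<subseteq> H \<inter> S" "card R = t + k" "coherent (\<bullet>) A g R"
        using m[of "H \<inter> S" g] S H by auto
      show ?thesis
        by (rule coherent_size_colouring[OF S g _ _ R(1,3,2) assms(1) i]) (use closed[OF H(1)] in blast)+
    qed
    then show "\<exists>c :: 'a set \<Rightarrow> nat. (\<forall>T. T \<subseteq> S \<and> card T = t \<longrightarrow> c T < k) \<and>
        (\<forall>H. homothet P H \<and> m \<le> card (H \<inter> S) \<longrightarrow>
           (\<forall>i<k. \<exists>T. T \<subseteq> H \<inter> S \<and> card T = t \<and> c T = i))"
      using assms(2) by (intro exI[of _ "\<lambda>T. coherent_size (\<bullet>) A g S T mod k"]) auto
  qed
qed

end
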